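(* Let $R$ be a ring, let $A=(a_{ij})_{i,j\in\mathbb{N}}$ be a countable column finite matrix with entries in $R$ such that $A^2=A$, and set $P=AR^{(\mathbb{N})}$. For any $k\ge 0$, let $I_k=\sum_{i>k,\ j\in\mathbb{N}}a_{ij}R$. Then: (i) $\mathrm{Tr}(P)=RI_0$. (ii) For any $k\ge 0$ and any $0<i\le k$, $$\Big(\sum_{j\in\mathbb{N}}a_{ij}R+RI_k\Big)/RI_k=\Big(\sum_{1\le\ell\le k}a_{i\ell}R+RI_k\Big)/RI_k.$$ In particular, if $0\le n\le k$, then $(I_n+RI_k)/RI_k$ is a finitely generated right ideal of $R/RI_k$. (iii) For any $k\ge 0$, $RI_k\in\mathcal{I}(P)$. (iv) For any $k\ge 0$, there exists $n_k>k$ such that $I_{n_k}I_k=I_{n_k}$.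
   Context: Rings are associative with $1$; $\mathbb{N}=\{1,2,\dots\}$. Column finite means each column has only finitely many nonzero entries, so $A$ acts by left multiplication on the free right module $R^{(\mathbb{N})}$ of column vectors. $\mathrm{Tr}(P)=\sum_{f\in \mathrm{Hom}_R(P,R)}f(P)$. For a right $R$-module $M$, $\mathcal{I}(M)$ denotes the set of two-sided ideals $I$ of $R$ such that $M/MI$ is finitely generated. Products of additive subgroups of $R$ are the additive subgroups generated by the products of elements. *)

theory Defs
  imports "HOL-Algebra.QuotRing" "HOL-Algebra.Generated_Groups"
begin

section \<open>Right modules\<close>

text \<open>
  The library's modules are left modules over commutative rings, so right modules over an arbitrary
  ring are introduced here. As for the library's modules, the record extends that of rings only to
  inherit the additive structure; the fields for multiplication and one are never looked at.
\<close>

record ('a, 'b) rmod = "'b ring" +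
  rsmult :: "'b \<Rightarrow> 'a \<Rightarrow> 'b"  (infixl \<open>\<bullet>\<index>\<close> 70)

locale right_module = R?: ring R + M?: abelian_group M
  for R (structure) and M :: "('a, 'b, 'm) rmod_scheme" (structure) +
  assumes rsmult_closed [simp, intro]:
      "\<lbrakk>x \<in> carrier M; a \<in> carrier R\<rbrakk> \<Longrightarrow> x \<bullet>\<^bsub>M\<^esub> a \<in> carrier M"
    and rsmult_r_distr:
      "\<lbrakk>x \<in> carrier M; a \<in> carrier R; b \<in> carrier R\<rbrakk>
        \<Longrightarrow> x \<bullet>\<^bsub>M\<^esub> (a \<oplus>\<^bsub>R\<^esub> b) = x \<bullet>\<^bsub>M\<^esub> a \<oplus>\<^bsub>M\<^esub> x \<bullet>\<^bsub>M\<^esub> b"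
    and rsmult_l_distr:
      "\<lbrakk>x \<in> carrier M; y \<in> carrier M; a \<in> carrier R\<rbrakk>
        \<Longrightarrow> (x \<oplus>\<^bsub>M\<^esub> y) \<bullet>\<^bsub>M\<^esub> a = x \<bullet>\<^bsub>M\<^esub> a \<oplus>\<^bsub>M\<^esub> y \<bullet>\<^bsub>M\<^esub> a"
    and rsmult_assoc:
      "\<lbrakk>x \<in> carrier M; a \<in> carrier R; b \<in> carrier R\<rbrakk>
        \<Longrightarrow> x \<bullet>\<^bsub>M\<^esub> (a \<otimes>\<^bsub>R\<^esub> b) = x \<bullet>\<^bsub>M\<^esub> a \<bullet>\<^bsub>M\<^esub> b"
    and rsmult_one [simp]: "x \<in> carrier M \<Longrightarrow> x \<bullet>\<^bsub>M\<^esub> \<one>\<^bsub>R\<^esub> = x"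

definition right_submodule :: "('a, 'r) ring_scheme \<Rightarrow> ('a, 'b, 'm) rmod_scheme \<Rightarrow> 'b set \<Rightarrow> bool"
  where "right_submodule R M N \<longleftrightarrow>
    additive_subgroup N M \<and> (\<forall>x\<in>N. \<forall>a\<in>carrier R. x \<bullet>\<^bsub>M\<^esub> a \<in> N)"

definition fin_gen_rmod :: "('a, 'r) ring_scheme \<Rightarrow> ('a, 'b, 'm) rmod_scheme \<Rightarrow> bool"
  where "fin_gen_rmod R M \<longleftrightarrow>
    (\<exists>F. finite F \<and> F \<subseteq> carrier M \<and>
      carrier M = generate (add_monoid M) {x \<bullet>\<^bsub>M\<^esub> a | x a. x \<in> F \<and> a \<in> carrier R})"

definition quotient_rmod ::
    "('a, 'b, 'm) rmod_scheme \<Rightarrow> 'b set \<Rightarrow> ('a, 'b set) rmod"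
  where "quotient_rmod M N =
    \<lparr>carrier = a_rcosets\<^bsub>M\<^esub> N, mult = undefined, one = undefined, zero = N, add = set_add M,
     rsmult = (\<lambda>X a. \<Union>x\<in>X. N +>\<^bsub>M\<^esub> (x \<bullet>\<^bsub>M\<^esub> a))\<rparr>"

definition regular_rmod :: "('a, 'r) ring_scheme \<Rightarrow> ('a, 'a) rmod"
  where "regular_rmod R =
    \<lparr>carrier = carrier R, mult = mult R, one = one R, zero = zero R, add = add R,
     rsmult = mult R\<rparr>"

definition fin_gen_right_ideal :: "('a, 'r) ring_scheme \<Rightarrow> 'a set \<Rightarrow> bool"
  where "fin_gen_right_ideal R J \<longleftrightarrow>
    right_submodule R (regular_rmod R) J \<and> fin_gen_rmod R ((regular_rmod R)\<lparr>carrier := J\<rparr>)"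

definition rmod_hom ::
    "('a, 'r) ring_scheme \<Rightarrow> ('a, 'b, 'm) rmod_scheme \<Rightarrow> ('a, 'c, 'n) rmod_scheme \<Rightarrow> ('b \<Rightarrow> 'c) set"
  where "rmod_hom R M N =
    {f \<in> hom (add_monoid M) (add_monoid N).
      \<forall>x\<in>carrier M. \<forall>a\<in>carrier R. f (x \<bullet>\<^bsub>M\<^esub> a) = f x \<bullet>\<^bsub>N\<^esub> a}"

section \<open>Sums and products of additive subgroups\<close>

definition sum_sets :: "('b, 'm) ring_scheme \<Rightarrow> 'b set set \<Rightarrow> 'b set"
  where "sum_sets M \<S> = generate (add_monoid M) (\<Union>\<S>)"

definition prod_sets :: "('a, 'r) ring_scheme \<Rightarrow> 'a set \<Rightarrow> 'a set \<Rightarrow> 'a set"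
  where "prod_sets R I J = generate (add_monoid R) {a \<otimes>\<^bsub>R\<^esub> b | a b. a \<in> I \<and> b \<in> J}"

definition rmod_prod :: "('a, 'b, 'm) rmod_scheme \<Rightarrow> 'a set \<Rightarrow> 'b set"
  where "rmod_prod M I = generate (add_monoid M) {x \<bullet>\<^bsub>M\<^esub> a | x a. x \<in> carrier M \<and> a \<in> I}"

definition trace_ideal :: "('a, 'r) ring_scheme \<Rightarrow> ('a, 'b, 'm) rmod_scheme \<Rightarrow> 'a set"
  where "trace_ideal R M = sum_sets R {f ` carrier M | f. f \<in> rmod_hom R M (regular_rmod R)}"

text \<open>The set $\mathcal{I}(M)$ of two-sided ideals $I$ with $M/MI$ finitely generated.\<close>

definition fin_gen_quotient_ideals ::
    "('a, 'r) ring_scheme \<Rightarrow> ('a, 'b, 'm) rmod_scheme \<Rightarrow> 'a set set"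
  where "fin_gen_quotient_ideals R M =
    {I. ideal I R \<and> fin_gen_rmod R (quotient_rmod M (rmod_prod M I))}"

text \<open>The subset $(X + K)/K$ of $R/K$.\<close>

definition sum_mod :: "('a, 'r) ring_scheme \<Rightarrow> 'a set \<Rightarrow> 'a set \<Rightarrow> 'a set set"
  where "sum_mod R X K = (\<lambda>x. K +>\<^bsub>R\<^esub> x) ` (X <+>\<^bsub>R\<^esub> K)"

section \<open>Countable column finite matrices\<close>

text \<open>
  Rows, columns and coordinates are indexed by the positive natural numbers. A matrix is a function
  on all pairs of natural numbers whose values at index 0 are irrelevant; a vector is a function
  on the natural numbers that vanishes at 0.
\<close>

definition free_rmod :: "('a, 'r) ring_scheme \<Rightarrow> ('a, nat \<Rightarrow> 'a) rmod"
  where "free_rmod R =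
    \<lparr>carrier = {v. (\<forall>i. v i \<in> carrier R) \<and> v 0 = \<zero>\<^bsub>R\<^esub> \<and> finite {i. v i \<noteq> \<zero>\<^bsub>R\<^esub>}},
     mult = undefined, one = undefined, zero = (\<lambda>_. \<zero>\<^bsub>R\<^esub>),
     add = (\<lambda>v w i. v i \<oplus>\<^bsub>R\<^esub> w i), rsmult = (\<lambda>v a i. v i \<otimes>\<^bsub>R\<^esub> a)\<rparr>"

definition column_finite :: "('a, 'r) ring_scheme \<Rightarrow> (nat \<Rightarrow> nat \<Rightarrow> 'a) \<Rightarrow> bool"
  where "column_finite R A \<longleftrightarrow> (\<forall>j\<in>{1..}. finite {i\<in>{1..}. A i j \<noteq> \<zero>\<^bsub>R\<^esub>})"

text \<open>
  The sums are restricted to the support of the vector, respectively of the column of the second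
  factor, because the sum over an infinite index set is zero by convention.
\<close>

definition mat_vec :: "('a, 'r) ring_scheme \<Rightarrow> (nat \<Rightarrow> nat \<Rightarrow> 'a) \<Rightarrow> (nat \<Rightarrow> 'a) \<Rightarrow> nat \<Rightarrow> 'a"
  where "mat_vec R A v i =
    (if i = 0 then \<zero>\<^bsub>R\<^esub> else \<Oplus>\<^bsub>R\<^esub>j\<in>{j\<in>{1..}. v j \<noteq> \<zero>\<^bsub>R\<^esub>}. A i j \<otimes>\<^bsub>R\<^esub> v j)"

definition mat_mult ::
    "('a, 'r) ring_scheme \<Rightarrow> (nat \<Rightarrow> nat \<Rightarrow> 'a) \<Rightarrow> (nat \<Rightarrow> nat \<Rightarrow> 'a) \<Rightarrow> nat \<Rightarrow> nat \<Rightarrow> 'a"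
  where "mat_mult R A B i j =
    (\<Oplus>\<^bsub>R\<^esub>l\<in>{l\<in>{1..}. B l j \<noteq> \<zero>\<^bsub>R\<^esub>}. A i l \<otimes>\<^bsub>R\<^esub> B l j)"

definition mat_image :: "('a, 'r) ring_scheme \<Rightarrow> (nat \<Rightarrow> nat \<Rightarrow> 'a) \<Rightarrow> ('a, nat \<Rightarrow> 'a) rmod"
  where "mat_image R A = (free_rmod R)\<lparr>carrier := mat_vec R A ` carrier (free_rmod R)\<rparr>"

text \<open>The right ideal $I_k = \sum_{i>k,\,j} a_{ij} R$.\<close>

definition tail_ideal :: "('a, 'r) ring_scheme \<Rightarrow> (nat \<Rightarrow> nat \<Rightarrow> 'a) \<Rightarrow> nat \<Rightarrow> 'a set"
  where "tail_ideal R A k = sum_sets R {A i j <#\<^bsub>R\<^esub> carrier R | i j. i > k \<and> j \<ge> 1}"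

section \<open>The constructions above yield right modules\<close>

lemma regular_right_module: "ring R \<Longrightarrow> right_module R (regular_rmod R)"
proof -
  assume "ring R"
  then interpret ring R .
  show ?thesis
    by (intro right_module.intro right_module_axioms.intro abelian_groupI)
      (auto simp: regular_rmod_def ring_axioms a_ac l_distr r_distr m_assoc
        intro: l_neg)
qed

lemma free_right_module: "ring R \<Longrightarrow> right_module R (free_rmod R)"
proof -
  assume "ring R"
  then interpret ring R .
  have fin_add: "finite {i. v i \<oplus>\<^bsub>R\<^esub> w i \<noteq> \<zero>\<^bsub>R\<^esub>}"
    if "finite {i. v i \<noteq> \<zero>\<^bsub>R\<^esub>}" "finite {i. w i \<noteq> \<zero>\<^bsub>R\<^esub>}" for v w :: "nat \<Rightarrow> 'a"
    by (rule finite_subset[OF _ finite_UnI[OF that]]) auto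
  have fin_mult: "finite {i. v i \<otimes>\<^bsub>R\<^esub> a \<noteq> \<zero>\<^bsub>R\<^esub>}"
    if "finite {i. v i \<noteq> \<zero>\<^bsub>R\<^esub>}" "a \<in> carrier R" for v :: "nat \<Rightarrow> 'a" and a
    by (rule finite_subset[OF _ that(1)]) (use that in auto)
  have neg: "\<exists>w\<in>carrier (free_rmod R). w \<oplus>\<^bsub>free_rmod R\<^esub> v = \<zero>\<^bsub>free_rmod R\<^esub>"
    if "v \<in> carrier (free_rmod R)" for v
  proof (rule bexI[of _ "\<lambda>i. \<ominus>\<^bsub>R\<^esub> v i"])
    show "(\<lambda>i. \<ominus>\<^bsub>R\<^esub> v i) \<oplus>\<^bsub>free_rmod R\<^esub> v = \<zero>\<^bsub>free_rmod R\<^esub>"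
      using that by (auto simp: free_rmod_def l_neg)
    have "finite {i. \<ominus>\<^bsub>R\<^esub> v i \<noteq> \<zero>\<^bsub>R\<^esub>}"
      by (rule finite_subset[of _ "{i. v i \<noteq> \<zero>\<^bsub>R\<^esub>}"]) (use that in \<open>auto simp: free_rmod_def\<close>)
    then show "(\<lambda>i. \<ominus>\<^bsub>R\<^esub> v i) \<in> carrier (free_rmod R)"
      using that by (auto simp: free_rmod_def)
  qed
  show ?thesis
  proof (intro right_module.intro right_module_axioms.intro abelian_groupI neg)
  qed (auto simp: free_rmod_def ring_axioms a_ac l_distr r_distr m_assoc fin_add fin_mult)
qed

lemma (in right_module) right_module_submodule:
  assumes "right_submodule R M N"
  shows "right_module R (M\<lparr>carrier := N\<rparr>)"
proof -
  interpret N: additive_subgroup N M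
    using assms by (simp add: right_submodule_def)
  have N: "x \<in> carrier M" if "x \<in> N" for x using that by (rule N.a_Hcarr)
  have neg: "\<exists>y\<in>N. x \<oplus>\<^bsub>M\<^esub> y = \<zero>\<^bsub>M\<^esub>" if "x \<in> N" for x
    using N.a_inv_closed[OF that] N[OF that] M.r_neg by blast
  show ?thesis
    using assms
    by (intro right_module.intro right_module_axioms.intro abelian_groupI)
      (auto simp: N R.ring_axioms M.a_ac M.l_zero rsmult_l_distr rsmult_r_distr rsmult_assoc
         right_submodule_def neg)
qed

lemma (in right_module) right_module_quotient:
  assumes "right_submodule R M N"
  shows "right_module R (quotient_rmod M N)"
proof -
  interpret N: abelian_subgroup N M
    using assms by (intro abelian_subgroupI3) (auto simp: right_submodule_def M.abelian_group_axioms)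
  have carr: "carrier (quotient_rmod M N) = (\<lambda>x. N +>\<^bsub>M\<^esub> x) ` carrier M"
    by (auto simp: quotient_rmod_def A_RCOSETS_def')
  have add: "(N +>\<^bsub>M\<^esub> x) \<oplus>\<^bsub>quotient_rmod M N\<^esub> (N +>\<^bsub>M\<^esub> y) = N +>\<^bsub>M\<^esub> (x \<oplus>\<^bsub>M\<^esub> y)"
    if "x \<in> carrier M" "y \<in> carrier M" for x y
    using N.a_rcos_sum[OF that] by (simp add: quotient_rmod_def)
  have zero: "\<zero>\<^bsub>quotient_rmod M N\<^esub> = N +>\<^bsub>M\<^esub> \<zero>\<^bsub>M\<^esub>"
    by (simp add: quotient_rmod_def N.a_rcos_const)
  have smult: "(N +>\<^bsub>M\<^esub> x) \<bullet>\<^bsub>quotient_rmod M N\<^esub> a = N +>\<^bsub>M\<^esub> (x \<bullet>\<^bsub>M\<^esub> a)"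
    if x: "x \<in> carrier M" and a: "a \<in> carrier R" for x a
  proof -
    have "N +>\<^bsub>M\<^esub> (y \<bullet>\<^bsub>M\<^esub> a) = N +>\<^bsub>M\<^esub> (x \<bullet>\<^bsub>M\<^esub> a)" if y: "y \<in> N +>\<^bsub>M\<^esub> x" for y
    proof -
      obtain h where h: "h \<in> N" "y = h \<oplus>\<^bsub>M\<^esub> x"
        using y by (auto simp: a_r_coset_def')
      then have "y \<bullet>\<^bsub>M\<^esub> a = h \<bullet>\<^bsub>M\<^esub> a \<oplus>\<^bsub>M\<^esub> x \<bullet>\<^bsub>M\<^esub> a"
        by (simp add: rsmult_l_distr x a)
      moreover have "h \<bullet>\<^bsub>M\<^esub> a \<in> N"
        using assms h a by (simp add: right_submodule_def)
      ultimately have "y \<bullet>\<^bsub>M\<^esub> a \<in> N +>\<^bsub>M\<^esub> (x \<bullet>\<^bsub>M\<^esub> a)"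
        by (auto simp: a_r_coset_def')
      then show ?thesis
        using N.a_repr_independence' x a by (metis rsmult_closed)
    qed
    moreover have "x \<in> N +>\<^bsub>M\<^esub> x" using x by (rule N.a_rcos_self)
    ultimately have "(\<Union>y\<in>N +>\<^bsub>M\<^esub> x. N +>\<^bsub>M\<^esub> (y \<bullet>\<^bsub>M\<^esub> a)) = N +>\<^bsub>M\<^esub> (x \<bullet>\<^bsub>M\<^esub> a)"
      by blast
    then show ?thesis by (simp add: quotient_rmod_def)
  qed
  have "abelian_group (quotient_rmod M N)"
  proof (rule comm_group_abelian_groupI)
    have "comm_group (add_monoid (quotient_rmod M N)) \<longleftrightarrow> comm_group (M A_Mod N)"
      by (simp only: quotient_rmod_def A_FactGroup_def' comm_group_def comm_monoid_def
          comm_monoid_axioms_def group_def group_axioms_def monoid_def Units_def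
          monoid.simps partial_object.simps ring.simps)
    then show "comm_group (add_monoid (quotient_rmod M N))"
      using N.a_factorgroup_is_comm_group by simp
  qed
  then show ?thesis
    by (intro right_module.intro right_module_axioms.intro)
      (auto simp: R.ring_axioms carr add smult rsmult_l_distr rsmult_r_distr rsmult_assoc)
qed

lemma (in right_module) right_submodule_rmod_prod:
  assumes "ideal I R"
  shows "right_submodule R M (rmod_prod M I)"
proof -
  interpret I: ideal I R by fact
  let ?S = "{x \<bullet>\<^bsub>M\<^esub> a | x a. x \<in> carrier M \<and> a \<in> I}"
  have S: "?S \<subseteq> carrier M" using I.a_Hcarr by auto
  have sub: "additive_subgroup (rmod_prod M I) M"
    unfolding rmod_prod_def using M.add.generate_is_subgroup[OF S] by (rule additive_subgroup.intro)
  have "x \<bullet>\<^bsub>M\<^esub> a \<in> rmod_prod M I" if a: "a \<in> carrier R" and x: "x \<in> rmod_prod M I" for x a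
    using x unfolding rmod_prod_def
  proof (induction rule: generate.induct)
    case one
    have "\<zero>\<^bsub>M\<^esub> \<bullet>\<^bsub>M\<^esub> a = \<zero>\<^bsub>M\<^esub>"
      using rsmult_l_distr[of "\<zero>\<^bsub>M\<^esub>" "\<zero>\<^bsub>M\<^esub>" a] a
      by (metis M.add.r_cancel_one M.l_zero M.zero_closed rsmult_closed)
    then show ?case using generate.one[of "add_monoid M"] by simp
  next
    case (incl h)
    then obtain x b where h: "h = x \<bullet>\<^bsub>M\<^esub> b" "x \<in> carrier M" "b \<in> I" by auto
    then have "h \<bullet>\<^bsub>M\<^esub> a = x \<bullet>\<^bsub>M\<^esub> (b \<otimes>\<^bsub>R\<^esub> a)" using a I.a_Hcarr by (simp add: rsmult_assoc)
    then show ?case using h a I.I_r_closed by (intro generate.incl) blast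
  next
    case (inv h)
    then obtain x b where h: "h = x \<bullet>\<^bsub>M\<^esub> b" "x \<in> carrier M" "b \<in> I" by auto
    have hM: "h \<in> carrier M" using h I.a_Hcarr by simp
    have z: "\<zero>\<^bsub>M\<^esub> \<bullet>\<^bsub>M\<^esub> a = \<zero>\<^bsub>M\<^esub>"
      using rsmult_l_distr[of "\<zero>\<^bsub>M\<^esub>" "\<zero>\<^bsub>M\<^esub>" a] a
      by (metis M.add.r_cancel_one M.l_zero M.zero_closed rsmult_closed)
    have "(\<ominus>\<^bsub>M\<^esub> h) \<bullet>\<^bsub>M\<^esub> a = \<ominus>\<^bsub>M\<^esub> (h \<bullet>\<^bsub>M\<^esub> a)"
      using rsmult_l_distr[of "\<ominus>\<^bsub>M\<^esub> h" h a] hM a z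
      by (metis M.l_neg M.a_inv_closed M.minus_equality rsmult_closed)
    moreover have "h \<bullet>\<^bsub>M\<^esub> a = x \<bullet>\<^bsub>M\<^esub> (b \<otimes>\<^bsub>R\<^esub> a)" using h a I.a_Hcarr by (simp add: rsmult_assoc)
    then have "h \<bullet>\<^bsub>M\<^esub> a \<in> ?S" using h a I.I_r_closed by blast
    then have "inv\<^bsub>add_monoid M\<^esub> (h \<bullet>\<^bsub>M\<^esub> a) \<in> generate (add_monoid M) ?S"
      by (rule generate.inv)
    ultimately show ?case by (simp add: a_inv_def)
  next
    case (eng h1 h2)
    have "h1 \<in> carrier M" "h2 \<in> carrier M"
      using eng(1,2) M.add.generate_in_carrier[OF S] by auto
    then show ?case
      using generate.eng[OF eng(3,4)] a by (simp add: rsmult_l_distr)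
  qed
  with sub show ?thesis by (simp add: right_submodule_def)
qed

lemma right_submodule_mat_image:
  assumes "ring R" and A: "\<forall>i\<in>{1..}. \<forall>j\<in>{1..}. A i j \<in> carrier R" and cf: "column_finite R A"
  shows "right_submodule R (free_rmod R) (carrier (mat_image R A))"
proof -
  interpret ring R by fact
  interpret F: right_module R "free_rmod R" by (rule free_right_module) fact
  let ?F = "carrier (free_rmod R)"
  have supp: "finite {j\<in>{1..}. v j \<noteq> \<zero>\<^bsub>R\<^esub>}" if "v \<in> ?F" for v
    using that by (auto simp: free_rmod_def)
  have Fc: "v i \<in> carrier R" if "v \<in> ?F" for v i
    using that by (auto simp: free_rmod_def)
  have vec_eq: "mat_vec R A v i = (\<Oplus>\<^bsub>R\<^esub>j\<in>J. A i j \<otimes>\<^bsub>R\<^esub> v j)"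
    if "v \<in> ?F" "i \<noteq> 0" "finite J" "J \<subseteq> {1..}" "{j\<in>{1..}. v j \<noteq> \<zero>\<^bsub>R\<^esub>} \<subseteq> J" for v i J
    unfolding mat_vec_def using that A Fc[OF that(1)]
    by (auto intro!: add.finprod_mono_neutral_cong_left)
  have vec: "mat_vec R A v i \<in> carrier R" if "v \<in> ?F" for v i
    using A Fc[OF that] by (auto simp: mat_vec_def)
  have vec_F: "mat_vec R A v \<in> ?F" if v: "v \<in> ?F" for v
  proof -
    have "{i. mat_vec R A v i \<noteq> \<zero>\<^bsub>R\<^esub>} \<subseteq>
        (\<Union>j\<in>{j\<in>{1..}. v j \<noteq> \<zero>\<^bsub>R\<^esub>}. {i\<in>{1..}. A i j \<noteq> \<zero>\<^bsub>R\<^esub>})"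
    proof (rule ccontr)
      assume "\<not> ?thesis"
      then obtain i where i: "mat_vec R A v i \<noteq> \<zero>\<^bsub>R\<^esub>"
        and n: "i \<notin> (\<Union>j\<in>{j\<in>{1..}. v j \<noteq> \<zero>\<^bsub>R\<^esub>}. {i\<in>{1..}. A i j \<noteq> \<zero>\<^bsub>R\<^esub>})" by blast
      from i have "i \<noteq> 0" by (metis mat_vec_def)
      with n have "\<forall>j\<in>{j\<in>{1..}. v j \<noteq> \<zero>\<^bsub>R\<^esub>}. A i j = \<zero>\<^bsub>R\<^esub>" by auto
      then have "mat_vec R A v i = \<zero>\<^bsub>R\<^esub>"
        using Fc[OF v] by (auto simp: mat_vec_def intro!: add.finprod_one_eqI)
      with i show False by simp
    qed
    moreover have "finite (\<Union>j\<in>{j\<in>{1..}. v j \<noteq> \<zero>\<^bsub>R\<^esub>}. {i\<in>{1..}. A i j \<noteq> \<zero>\<^bsub>R\<^esub>})"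
      using supp[OF v] cf by (auto simp: column_finite_def)
    ultimately have "finite {i. mat_vec R A v i \<noteq> \<zero>\<^bsub>R\<^esub>}" by (rule finite_subset)
    moreover have "mat_vec R A v 0 = \<zero>\<^bsub>R\<^esub>" by (simp add: mat_vec_def)
    ultimately show ?thesis
      using vec[OF v] by (simp add: free_rmod_def)
  qed
  have add: "mat_vec R A v \<oplus>\<^bsub>free_rmod R\<^esub> mat_vec R A w = mat_vec R A (v \<oplus>\<^bsub>free_rmod R\<^esub> w)"
    if v: "v \<in> ?F" and w: "w \<in> ?F" for v w
  proof (rule ext)
    fix i
    let ?J = "{j\<in>{1..}. v j \<noteq> \<zero>\<^bsub>R\<^esub>} \<union> {j\<in>{1..}. w j \<noteq> \<zero>\<^bsub>R\<^esub>}"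
    have J: "finite ?J" "?J \<subseteq> {1..}" using supp[OF v] supp[OF w] by auto
    have p: "(v \<oplus>\<^bsub>free_rmod R\<^esub> w) j = v j \<oplus>\<^bsub>R\<^esub> w j" for v w j by (simp add: free_rmod_def)
    show "(mat_vec R A v \<oplus>\<^bsub>free_rmod R\<^esub> mat_vec R A w) i = mat_vec R A (v \<oplus>\<^bsub>free_rmod R\<^esub> w) i"
    proof (cases "i = 0")
      case True
      then show ?thesis by (simp add: p mat_vec_def)
    next
      case False
      have "mat_vec R A (v \<oplus>\<^bsub>free_rmod R\<^esub> w) i
          = (\<Oplus>\<^bsub>R\<^esub>j\<in>?J. A i j \<otimes>\<^bsub>R\<^esub> (v \<oplus>\<^bsub>free_rmod R\<^esub> w) j)"
        using False J v w by (intro vec_eq) (auto simp: p)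
      also have "\<dots> = (\<Oplus>\<^bsub>R\<^esub>j\<in>?J. A i j \<otimes>\<^bsub>R\<^esub> v j \<oplus>\<^bsub>R\<^esub> A i j \<otimes>\<^bsub>R\<^esub> w j)"
        using A False Fc v w by (intro add.finprod_cong') (auto simp: p r_distr)
      also have "\<dots> = (\<Oplus>\<^bsub>R\<^esub>j\<in>?J. A i j \<otimes>\<^bsub>R\<^esub> v j) \<oplus>\<^bsub>R\<^esub> (\<Oplus>\<^bsub>R\<^esub>j\<in>?J. A i j \<otimes>\<^bsub>R\<^esub> w j)"
        using A False Fc v w by (intro add.finprod_multf) auto
      also have "\<dots> = mat_vec R A v i \<oplus>\<^bsub>R\<^esub> mat_vec R A w i"
        using False J v w by (subst (1 2) vec_eq[where J = ?J]) auto
      finally show ?thesis by (simp add: p)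
    qed
  qed
  have smult: "mat_vec R A v \<bullet>\<^bsub>free_rmod R\<^esub> a = mat_vec R A (v \<bullet>\<^bsub>free_rmod R\<^esub> a)"
    if v: "v \<in> ?F" and a: "a \<in> carrier R" for v a
  proof (rule ext)
    fix i
    let ?J = "{j\<in>{1..}. v j \<noteq> \<zero>\<^bsub>R\<^esub>}"
    have p: "(v \<bullet>\<^bsub>free_rmod R\<^esub> a) j = v j \<otimes>\<^bsub>R\<^esub> a" for v j by (simp add: free_rmod_def)
    show "(mat_vec R A v \<bullet>\<^bsub>free_rmod R\<^esub> a) i = mat_vec R A (v \<bullet>\<^bsub>free_rmod R\<^esub> a) i"
    proof (cases "i = 0")
      case True
      then show ?thesis by (simp add: p mat_vec_def a)
    next
      case False
      have "mat_vec R A (v \<bullet>\<^bsub>free_rmod R\<^esub> a) i = (\<Oplus>\<^bsub>R\<^esub>j\<in>?J. A i j \<otimes>\<^bsub>R\<^esub> (v \<bullet>\<^bsub>free_rmod R\<^esub> a) j)"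
        using False supp[OF v] v a by (intro vec_eq) (auto simp: p)
      also have "\<dots> = (\<Oplus>\<^bsub>R\<^esub>j\<in>?J. (A i j \<otimes>\<^bsub>R\<^esub> v j) \<otimes>\<^bsub>R\<^esub> a)"
        using A False Fc v a by (intro add.finprod_cong') (auto simp: p m_assoc)
      also have "\<dots> = (\<Oplus>\<^bsub>R\<^esub>j\<in>?J. A i j \<otimes>\<^bsub>R\<^esub> v j) \<otimes>\<^bsub>R\<^esub> a"
        using A False Fc v a supp[OF v] by (intro finsum_ldistr[symmetric]) auto
      finally show ?thesis using False by (simp add: p mat_vec_def)
    qed
  qed
  have zero: "\<zero>\<^bsub>free_rmod R\<^esub> = mat_vec R A \<zero>\<^bsub>free_rmod R\<^esub>"
    by (auto simp: free_rmod_def mat_vec_def)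
  have inv: "\<ominus>\<^bsub>free_rmod R\<^esub> mat_vec R A v = mat_vec R A (\<ominus>\<^bsub>free_rmod R\<^esub> v)" if v: "v \<in> ?F" for v
    using add[of "\<ominus>\<^bsub>free_rmod R\<^esub> v" v] v vec_F zero
    by (metis F.M.a_inv_closed F.M.l_neg F.M.minus_equality)
  have "additive_subgroup (mat_vec R A ` ?F) (free_rmod R)"
    by (intro additive_subgroup.intro F.M.add.subgroupI)
      (use vec_F add inv in \<open>auto simp: a_inv_def[symmetric] image_iff intro: F.M.a_inv_closed F.M.a_closed\<close>)
  then show ?thesis
    using smult by (auto simp: right_submodule_def mat_image_def)
qed

end

theory Submission
  imports Defs
begin

text \<open>
  Everything follows from $a_{ij} = \sum_l a_{il} a_{lj}$. The terms with $l > k$ lie in $R I_k$, so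
  modulo $R I_k$ a row is generated by its first $k$ entries. Read columnwise, the identity says that
  the $j$-th column $c_j = A e_j$ of $A$ equals $\sum_l c_l a_{lj}$: hence $c_1, \dots, c_k$ generate
  $P$ modulo $P I_k$, and every $f : P \to R$ satisfies $f(c_j) = \sum_l f(c_l) a_{lj} \in R I_0$, while
  the maps $x \mapsto r x_i$ give the reverse inclusion. Finally, column finiteness provides $n > k$ such
  that $a_{il} = 0$ for $i > n$ and $l \le k$, and then $a_{ij} = \sum_{l>k} a_{il} a_{lj} \in I_n I_k$.
\<close>

section \<open>Additive subgroups and homomorphisms\<close>

text \<open>An infinite index set is covered too: \<open>finsum\<close> is then zero by convention,
  and zero lies in \<open>N\<close>.\<close>

lemma (in abelian_group) finsum_in_additive_subgroup:
  assumes "additive_subgroup N G" and "\<And>x. x \<in> S \<Longrightarrow> f x \<in> N"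
  shows "finsum G f S \<in> N"
proof -
  interpret N: additive_subgroup N G by fact
  show ?thesis
    using assms(2)
  proof (induction S rule: infinite_finite_induct)
    case (insert x S)
    then have "f x \<in> N" "finsum G f S \<in> N" by auto
    moreover have "f \<in> S \<rightarrow> carrier G" "f x \<in> carrier G" using insert.prems by auto
    ultimately show ?case using insert.hyps by (simp add: finsum_insert)
  qed auto
qed

lemma (in abelian_group) additive_subgroup_generate:
  assumes "S \<subseteq> carrier G"
  shows "additive_subgroup (generate (add_monoid G) S) G"
  using add.generate_is_subgroup assms by (intro additive_subgroupI) simp

lemma (in abelian_group) generate_subset_additive_subgroup:
  assumes "additive_subgroup N G" and "S \<subseteq> N"
  shows "generate (add_monoid G) S \<subseteq> N"
  using assms add.generate_subgroup_incl by (simp add: additive_subgroup_def)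

lemma abelian_group_homI':
  assumes "abelian_group G" and "abelian_group H"
    and "\<And>x. x \<in> carrier G \<Longrightarrow> h x \<in> carrier H"
    and "\<And>x y. \<lbrakk>x \<in> carrier G; y \<in> carrier G\<rbrakk> \<Longrightarrow> h (x \<oplus>\<^bsub>G\<^esub> y) = h x \<oplus>\<^bsub>H\<^esub> h y"
  shows "abelian_group_hom G H h"
proof -
  interpret G: abelian_group G by fact
  interpret H: abelian_group H by fact
  show ?thesis
    by (intro abelian_group_homI group_hom.intro group_hom_axioms.intro homI)
      (use assms in \<open>auto simp: G.add.is_group H.add.is_group\<close>)
qed

lemma (in abelian_group_hom) additive_subgroup_preimage:
  assumes "additive_subgroup N H"
  shows "additive_subgroup {x \<in> carrier G. h x \<in> N} G"
proof -
  interpret N: additive_subgroup N H by fact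
  show ?thesis
    by (intro additive_subgroupI G.add.subgroupI)
      (auto simp: N.zero_closed N.a_closed N.a_inv_closed a_inv_def[symmetric])
qed

text \<open>Reduces closure properties of a generated subgroup to its generators, which replaces
  repeated inductions over \<open>generate\<close>.\<close>

lemma (in abelian_group_hom) generate_in_preimage:
  assumes "additive_subgroup N H" and "S \<subseteq> carrier G" and "\<And>x. x \<in> S \<Longrightarrow> h x \<in> N"
    and "x \<in> generate (add_monoid G) S"
  shows "h x \<in> N"
  using G.generate_subset_additive_subgroup[OF additive_subgroup_preimage[OF assms(1)], of S]
    assms by auto

section \<open>Submodules and finite generation\<close>

context right_module
begin

lemma rsmult_hom:
  assumes "a \<in> carrier R"
  shows "abelian_group_hom M M (\<lambda>x. x \<bullet>\<^bsub>M\<^esub> a)"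
  using assms by (intro abelian_group_homI') (auto simp: M.abelian_group_axioms rsmult_l_distr)

lemma right_submodule_generate:
  assumes "S \<subseteq> carrier M"
    and "\<And>x a. \<lbrakk>x \<in> S; a \<in> carrier R\<rbrakk> \<Longrightarrow> x \<bullet>\<^bsub>M\<^esub> a \<in> generate (add_monoid M) S"
  shows "right_submodule R M (generate (add_monoid M) S)"
  unfolding right_submodule_def
proof (intro conjI ballI)
  show sub: "additive_subgroup (generate (add_monoid M) S) M"
    using assms(1) by (rule M.additive_subgroup_generate)
  fix x a assume x: "x \<in> generate (add_monoid M) S" and a: "a \<in> carrier R"
  show "x \<bullet>\<^bsub>M\<^esub> a \<in> generate (add_monoid M) S"
    by (rule abelian_group_hom.generate_in_preimage[OF rsmult_hom[OF a] sub assms(1) _ x])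
      (intro assms(2) a)
qed

text \<open>Finite generation by minimality, without linear combinations: the additive subgroup
  generated by the products of elements of \<open>F\<close> with scalars is itself a submodule
  containing \<open>F\<close>, so \<open>min\<close> applies to it.\<close>

lemma fin_gen_submoduleI:
  assumes J: "right_submodule R M J" and F: "finite F" "F \<subseteq> J"
    and min: "\<And>N. \<lbrakk>right_submodule R M N; F \<subseteq> N\<rbrakk> \<Longrightarrow> J \<subseteq> N"
  shows "fin_gen_rmod R (M\<lparr>carrier := J\<rparr>)"
proof -
  let ?S = "{x \<bullet>\<^bsub>M\<^esub> a | x a. x \<in> F \<and> a \<in> carrier R}"
  interpret J: additive_subgroup J M using J by (simp add: right_submodule_def)
  have SJ: "?S \<subseteq> J" using J F by (auto simp: right_submodule_def)
  have SM: "?S \<subseteq> carrier M" using SJ J.a_subset by blast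
  have FM: "x \<in> carrier M" if "x \<in> F" for x using that F J.a_subset by blast
  have sub: "right_submodule R M (generate (add_monoid M) ?S)"
  proof (rule right_submodule_generate[OF SM])
    fix y b assume "y \<in> ?S" and b: "b \<in> carrier R"
    then obtain x a where "y = x \<bullet>\<^bsub>M\<^esub> a" "x \<in> F" "a \<in> carrier R" by blast
    then have "y \<bullet>\<^bsub>M\<^esub> b = x \<bullet>\<^bsub>M\<^esub> (a \<otimes>\<^bsub>R\<^esub> b)" "x \<in> F" "a \<otimes>\<^bsub>R\<^esub> b \<in> carrier R"
      using b FM by (auto simp: rsmult_assoc)
    then show "y \<bullet>\<^bsub>M\<^esub> b \<in> generate (add_monoid M) ?S"
      by (intro generate.incl) blast
  qed
  have "F \<subseteq> generate (add_monoid M) ?S"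
  proof
    fix x assume x: "x \<in> F"
    then have "x = x \<bullet>\<^bsub>M\<^esub> \<one>\<^bsub>R\<^esub>" using FM by simp
    with x have "x \<in> ?S" by blast
    then show "x \<in> generate (add_monoid M) ?S" by (rule generate.incl)
  qed
  then have "J \<subseteq> generate (add_monoid M) ?S" using min sub by blast
  moreover have "generate (add_monoid M) ?S \<subseteq> J"
    using M.generate_subset_additive_subgroup[OF J.additive_subgroup_axioms SJ] .
  \<comment> \<open>The carrier enters \<open>generate\<close> through the inverse, so subgroups
    generated inside \<open>J\<close> and inside \<open>M\<close> have to be identified.\<close>
  moreover have "generate (add_monoid (M\<lparr>carrier := J\<rparr>)) ?S = generate (add_monoid M) ?S"
    using M.add.generate_consistent[OF SJ J.a_subgroup] by simp
  ultimately show ?thesis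
    unfolding fin_gen_rmod_def using F by (intro exI[of _ F]) auto
qed

lemma a_rcos_hom:
  assumes "right_submodule R M N"
  shows "abelian_group_hom M (quotient_rmod M N) (\<lambda>x. N +>\<^bsub>M\<^esub> x)"
proof -
  interpret N: abelian_subgroup N M
    using assms by (intro abelian_subgroupI3) (auto simp: right_submodule_def M.abelian_group_axioms)
  interpret Q: right_module R "quotient_rmod M N" using assms by (rule right_module_quotient)
  show ?thesis
    by (intro abelian_group_homI' M.abelian_group_axioms Q.M.abelian_group_axioms)
      (auto simp: quotient_rmod_def A_RCOSETS_def' N.a_rcos_sum)
qed

text \<open>The action on cosets is a union over all representatives. Two representatives differ by
  some \<open>h\<close> in \<open>N\<close>, and \<open>N\<close> is closed under the action, so all
  members of this nonempty union are the same coset.\<close>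

lemma quotient_rsmult:
  assumes N: "right_submodule R M N" and x: "x \<in> carrier M" and a: "a \<in> carrier R"
  shows "(N +>\<^bsub>M\<^esub> x) \<bullet>\<^bsub>quotient_rmod M N\<^esub> a = N +>\<^bsub>M\<^esub> (x \<bullet>\<^bsub>M\<^esub> a)"
proof -
  interpret N: abelian_subgroup N M
    using N by (intro abelian_subgroupI3) (auto simp: right_submodule_def M.abelian_group_axioms)
  have "N +>\<^bsub>M\<^esub> (y \<bullet>\<^bsub>M\<^esub> a) = N +>\<^bsub>M\<^esub> (x \<bullet>\<^bsub>M\<^esub> a)" if y: "y \<in> N +>\<^bsub>M\<^esub> x" for y
  proof -
    obtain h where h: "h \<in> N" "y = h \<oplus>\<^bsub>M\<^esub> x" using y by (auto simp: a_r_coset_def')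
    then have "y \<bullet>\<^bsub>M\<^esub> a = h \<bullet>\<^bsub>M\<^esub> a \<oplus>\<^bsub>M\<^esub> x \<bullet>\<^bsub>M\<^esub> a" by (simp add: rsmult_l_distr x a)
    moreover have "h \<bullet>\<^bsub>M\<^esub> a \<in> N" using N h a by (simp add: right_submodule_def)
    ultimately have "y \<bullet>\<^bsub>M\<^esub> a \<in> N +>\<^bsub>M\<^esub> (x \<bullet>\<^bsub>M\<^esub> a)" by (auto simp: a_r_coset_def')
    then show ?thesis using N.a_repr_independence' x a by (metis rsmult_closed)
  qed
  moreover have "x \<in> N +>\<^bsub>M\<^esub> x" using x by (rule N.a_rcos_self)
  ultimately have "(\<Union>y\<in>N +>\<^bsub>M\<^esub> x. N +>\<^bsub>M\<^esub> (y \<bullet>\<^bsub>M\<^esub> a)) = N +>\<^bsub>M\<^esub> (x \<bullet>\<^bsub>M\<^esub> a)"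
    by blast
  then show ?thesis by (simp add: quotient_rmod_def)
qed

text \<open>Generators of \<open>M\<close> modulo \<open>N\<close> can be tested upstairs: the
  preimage of a submodule of the quotient is a submodule of \<open>M\<close> that contains
  \<open>N\<close>.\<close>

lemma fin_gen_quotientI:
  assumes N: "right_submodule R M N" and F: "finite F" "F \<subseteq> carrier M"
    and min: "\<And>L. \<lbrakk>right_submodule R M L; N \<subseteq> L; F \<subseteq> L\<rbrakk> \<Longrightarrow> carrier M \<subseteq> L"
  shows "fin_gen_rmod R (quotient_rmod M N)"
proof -
  let ?Q = "quotient_rmod M N" and ?p = "\<lambda>x. N +>\<^bsub>M\<^esub> x"
  interpret N: abelian_subgroup N M
    using N by (intro abelian_subgroupI3) (auto simp: right_submodule_def M.abelian_group_axioms)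
  interpret Q: right_module R ?Q using N by (rule right_module_quotient)
  interpret p: abelian_group_hom M ?Q ?p using N by (rule a_rcos_hom)
  have carr: "carrier ?Q = ?p ` carrier M" by (auto simp: quotient_rmod_def A_RCOSETS_def')
  \<comment> \<open>The quotient is regarded as a submodule of itself to match
    \<open>fin_gen_submoduleI\<close>.\<close>
  have "fin_gen_rmod R (?Q\<lparr>carrier := carrier ?Q\<rparr>)"
  proof (rule Q.fin_gen_submoduleI[of _ "?p ` F"])
    show "right_submodule R ?Q (carrier ?Q)"
      unfolding right_submodule_def
      by (intro conjI ballI Q.rsmult_closed additive_subgroupI) (rule Q.M.add.subgroup_self)
    fix L assume L: "right_submodule R ?Q L" "?p ` F \<subseteq> L"
    then interpret L: additive_subgroup L ?Q by (simp add: right_submodule_def)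
    let ?L = "{x \<in> carrier M. ?p x \<in> L}"
    have "right_submodule R M ?L"
      using L p.additive_subgroup_preimage[OF L.additive_subgroup_axioms]
      by (auto simp: right_submodule_def quotient_rsmult[OF N, symmetric])
    moreover have "N \<subseteq> ?L"
    proof
      fix x assume x: "x \<in> N"
      then have "?p x = \<zero>\<^bsub>?Q\<^esub>" by (simp add: N.a_rcos_const quotient_rmod_def)
      then have "?p x \<in> L" using L.zero_closed by metis
      then show "x \<in> ?L" using x N.a_Hcarr by simp
    qed
    moreover have "F \<subseteq> ?L" using F L(2) by auto
    ultimately have "carrier M \<subseteq> ?L" by (rule min)
    then show "carrier ?Q \<subseteq> L" by (auto simp: carr)
  qed (use F carr in auto)
  then show ?thesis by simp
qed

end

section \<open>Right ideals\<close>

lemma additive_subgroup_regular_rmod: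
  "additive_subgroup N (regular_rmod R) \<longleftrightarrow> additive_subgroup N R"
  by (simp add: additive_subgroup_def subgroup_def regular_rmod_def m_inv_def)

text \<open>Right ideals remain submodules of the regular module, so that
  \<open>fin_gen_submoduleI\<close> applies to them directly.\<close>

abbreviation right_ideal :: "('a, 'r) ring_scheme \<Rightarrow> 'a set \<Rightarrow> bool"
  where "right_ideal R N \<equiv> right_submodule R (regular_rmod R) N"

lemma right_ideal_iff:
  "right_ideal R N \<longleftrightarrow> additive_subgroup N R \<and> (\<forall>x\<in>N. \<forall>a\<in>carrier R. x \<otimes>\<^bsub>R\<^esub> a \<in> N)"
  unfolding right_submodule_def additive_subgroup_regular_rmod by (simp add: regular_rmod_def)

context ring
begin

lemma r_mult_hom: "a \<in> carrier R \<Longrightarrow> abelian_group_hom R R (\<lambda>x. x \<otimes> a)"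
  by (intro abelian_group_homI') (auto simp: abelian_group_axioms l_distr)

lemma l_mult_hom: "a \<in> carrier R \<Longrightarrow> abelian_group_hom R R (\<lambda>x. a \<otimes> x)"
  by (intro abelian_group_homI') (auto simp: abelian_group_axioms r_distr)

lemma right_ideal_generate:
  assumes S: "S \<subseteq> carrier R" and "\<And>x a. \<lbrakk>x \<in> S; a \<in> carrier R\<rbrakk> \<Longrightarrow> x \<otimes> a \<in> S"
  shows "right_ideal R (generate (add_monoid R) S)"
  unfolding right_ideal_iff
proof (intro conjI ballI)
  show sub: "additive_subgroup (generate (add_monoid R) S) R"
    using S by (rule additive_subgroup_generate)
  fix x a assume x: "x \<in> generate (add_monoid R) S" and a: "a \<in> carrier R"
  show "x \<otimes> a \<in> generate (add_monoid R) S"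
    by (rule abelian_group_hom.generate_in_preimage[OF r_mult_hom[OF a] sub S _ x])
      (intro generate.incl assms(2) a)
qed

text \<open>Together with the next two lemmas this identifies the sum of the principal right ideals
  of elements of \<open>T\<close> as the least right ideal containing \<open>T\<close>, so
  inclusions can be checked on generators.\<close>

lemma right_ideal_sum_principal:
  assumes "T \<subseteq> carrier R"
  shows "right_ideal R (sum_sets R ((\<lambda>a. a <#\<^bsub>R\<^esub> carrier R) ` T))"
  unfolding sum_sets_def
proof (rule right_ideal_generate)
  show "\<Union> ((\<lambda>a. a <#\<^bsub>R\<^esub> carrier R) ` T) \<subseteq> carrier R"
    using assms by (auto simp: l_coset_def)
  fix x b assume x: "x \<in> \<Union> ((\<lambda>a. a <#\<^bsub>R\<^esub> carrier R) ` T)" and b: "b \<in> carrier R"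
  from x obtain a c where ac: "a \<in> T" "c \<in> carrier R" "x = a \<otimes> c" by (auto simp: l_coset_def)
  then have "x \<otimes> b = a \<otimes> (c \<otimes> b)" using assms b by (auto simp: m_assoc)
  then show "x \<otimes> b \<in> \<Union> ((\<lambda>a. a <#\<^bsub>R\<^esub> carrier R) ` T)"
    using ac b by (auto simp: l_coset_def)
qed

lemma generators_in_sum_principal:
  assumes "T \<subseteq> carrier R"
  shows "T \<subseteq> sum_sets R ((\<lambda>a. a <#\<^bsub>R\<^esub> carrier R) ` T)"
proof
  fix a assume a: "a \<in> T"
  then have "a = a \<otimes> \<one>" using assms by auto
  then have "a \<in> a <#\<^bsub>R\<^esub> carrier R" by (auto simp: l_coset_def)
  then show "a \<in> sum_sets R ((\<lambda>a. a <#\<^bsub>R\<^esub> carrier R) ` T)"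
    unfolding sum_sets_def using a by (intro generate.incl) blast
qed

lemma sum_principal_subset:
  assumes "right_ideal R N" and "T \<subseteq> N"
  shows "sum_sets R ((\<lambda>a. a <#\<^bsub>R\<^esub> carrier R) ` T) \<subseteq> N"
  unfolding sum_sets_def
  by (rule generate_subset_additive_subgroup)
    (use assms in \<open>auto simp: right_ideal_iff l_coset_def\<close>)

section \<open>Products of additive subgroups and the ideal generated by a right ideal\<close>

lemma prod_sets_in:
  "\<lbrakk>a \<in> I; b \<in> J\<rbrakk> \<Longrightarrow> a \<otimes> b \<in> prod_sets R I J"
  unfolding prod_sets_def by (intro generate.incl) blast

lemma prod_sets_subset:
  assumes "additive_subgroup N R" and "\<And>a b. \<lbrakk>a \<in> I; b \<in> J\<rbrakk> \<Longrightarrow> a \<otimes> b \<in> N"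
  shows "prod_sets R I J \<subseteq> N"
  unfolding prod_sets_def
  by (rule generate_subset_additive_subgroup) (use assms in auto)

lemma right_ideal_subset: "right_ideal R I \<Longrightarrow> I \<subseteq> carrier R"
  by (auto simp: right_ideal_iff dest: additive_subgroup.a_subset)

lemma right_ideal_prod_sets:
  assumes "I \<subseteq> carrier R" and J: "right_ideal R J"
  shows "right_ideal R (prod_sets R I J)"
  unfolding prod_sets_def
proof (rule right_ideal_generate)
  show "{a \<otimes> b |a b. a \<in> I \<and> b \<in> J} \<subseteq> carrier R"
    using assms(1) right_ideal_subset[OF J] by auto
  fix x c assume "x \<in> {a \<otimes> b |a b. a \<in> I \<and> b \<in> J}" and c: "c \<in> carrier R"
  then obtain a b where ab: "x = a \<otimes> b" "a \<in> I" "b \<in> J" by blast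
  then have "x \<otimes> c = a \<otimes> (b \<otimes> c)" using assms(1) right_ideal_subset[OF J] c by (simp add: m_assoc subset_iff)
  moreover have "b \<otimes> c \<in> J" using J ab c by (simp add: right_ideal_iff)
  ultimately show "x \<otimes> c \<in> {a \<otimes> b |a b. a \<in> I \<and> b \<in> J}" using ab by blast
qed

text \<open>By associativity a left factor is absorbed by \<open>carrier R\<close> and a right
  factor by \<open>J\<close>.\<close>

lemma ideal_prod_carrier:
  assumes J: "right_ideal R J"
  shows "ideal (prod_sets R (carrier R) J) R"
proof (rule idealI)
  have r: "right_ideal R (prod_sets R (carrier R) J)"
    by (rule right_ideal_prod_sets) (use J in auto)
  then have sub: "additive_subgroup (prod_sets R (carrier R) J) R" by (simp add: right_ideal_iff)
  then show "subgroup (prod_sets R (carrier R) J) (add_monoid R)" by (simp add: additive_subgroup_def)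
  fix x c assume x: "x \<in> prod_sets R (carrier R) J" and c: "c \<in> carrier R"
  then show "x \<otimes> c \<in> prod_sets R (carrier R) J" using r by (simp add: right_ideal_iff)
  show "c \<otimes> x \<in> prod_sets R (carrier R) J"
  proof (rule abelian_group_hom.generate_in_preimage[OF l_mult_hom[OF c] sub])
    show "x \<in> generate (add_monoid R) {a \<otimes> b |a b. a \<in> carrier R \<and> b \<in> J}"
      using x by (simp add: prod_sets_def)
    show "{a \<otimes> b |a b. a \<in> carrier R \<and> b \<in> J} \<subseteq> carrier R"
      using right_ideal_subset[OF J] by auto
    fix y assume "y \<in> {a \<otimes> b |a b. a \<in> carrier R \<and> b \<in> J}"
    then obtain a b where ab: "y = a \<otimes> b" "a \<in> carrier R" "b \<in> J" by blast
    then have "c \<otimes> y = (c \<otimes> a) \<otimes> b" using c right_ideal_subset[OF J] by (auto simp: m_assoc)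
    then show "c \<otimes> y \<in> prod_sets R (carrier R) J" using ab c by (simp add: prod_sets_in)
  qed
qed (rule ring_axioms)

lemma subset_prod_carrier:
  assumes "J \<subseteq> carrier R"
  shows "J \<subseteq> prod_sets R (carrier R) J"
proof
  fix x assume x: "x \<in> J"
  then have "\<one> \<otimes> x \<in> prod_sets R (carrier R) J" by (intro prod_sets_in) auto
  then show "x \<in> prod_sets R (carrier R) J" using x assms by (simp add: subset_iff)
qed

section \<open>Sums of right ideals and their images in a quotient ring\<close>

lemma right_ideal_set_add:
  assumes "right_ideal R I" and "right_ideal R J"
  shows "right_ideal R (I <+>\<^bsub>R\<^esub> J)"
  unfolding right_ideal_iff
proof (intro conjI ballI)
  show "additive_subgroup (I <+>\<^bsub>R\<^esub> J) R"
    using assms by (intro add_additive_subgroups) (auto simp: right_ideal_iff)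
  fix x a assume "x \<in> I <+>\<^bsub>R\<^esub> J" and a: "a \<in> carrier R"
  then obtain i j where ij: "i \<in> I" "j \<in> J" "x = i \<oplus> j"
    unfolding set_add_def' by blast
  then have "x \<otimes> a = i \<otimes> a \<oplus> j \<otimes> a"
    using a assms[THEN right_ideal_subset] by (simp add: l_distr subset_iff)
  moreover have "i \<otimes> a \<in> I" "j \<otimes> a \<in> J" using assms ij(1,2) a unfolding right_ideal_iff by blast+
  ultimately show "x \<otimes> a \<in> I <+>\<^bsub>R\<^esub> J" by (simp only: set_add_def') blast
qed

lemma subset_set_add1:
  assumes "additive_subgroup J R" and "I \<subseteq> carrier R"
  shows "I \<subseteq> I <+>\<^bsub>R\<^esub> J"
proof
  fix x assume x: "x \<in> I"
  then have "x \<oplus> \<zero> \<in> I <+>\<^bsub>R\<^esub> J"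
    using additive_subgroup.zero_closed[OF assms(1)] unfolding set_add_def' by blast
  moreover have "x \<in> carrier R" using x assms(2) by blast
  ultimately show "x \<in> I <+>\<^bsub>R\<^esub> J" by simp
qed

lemma subset_set_add2:
  assumes "additive_subgroup I R" and "J \<subseteq> carrier R"
  shows "J \<subseteq> I <+>\<^bsub>R\<^esub> J"
proof
  fix x assume x: "x \<in> J"
  then have "\<zero> \<oplus> x \<in> I <+>\<^bsub>R\<^esub> J"
    using additive_subgroup.zero_closed[OF assms(1)] unfolding set_add_def' by blast
  moreover have "x \<in> carrier R" using x assms(2) by blast
  ultimately show "x \<in> I <+>\<^bsub>R\<^esub> J" by simp
qed

lemma set_add_subset:
  assumes "additive_subgroup N R" and "I \<subseteq> N" and "J \<subseteq> N"
  shows "I <+>\<^bsub>R\<^esub> J \<subseteq> N"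
  using assms additive_subgroup.a_closed[OF assms(1)] unfolding set_add_def' by blast

lemma right_ideal_ideal:
  assumes "ideal K R"
  shows "right_ideal R K"
proof -
  interpret K: ideal K R by fact
  show ?thesis
    unfolding right_ideal_iff by (intro conjI ballI K.I_r_closed K.additive_subgroup_axioms)
qed

text \<open>The analogue of \<open>fin_gen_quotientI\<close> for right ideals of
  \<open>R Quot K\<close>: each of them pulls back to a right ideal of \<open>R\<close> containing
  \<open>K\<close>, so minimality is only required there.\<close>

lemma fin_gen_right_ideal_sum_modI:
  assumes K: "ideal K R" and X: "right_ideal R X" and F: "finite F" "F \<subseteq> X"
    and min: "\<And>L. \<lbrakk>right_ideal R L; K \<subseteq> L; F \<subseteq> L\<rbrakk> \<Longrightarrow> X \<subseteq> L"
  shows "fin_gen_right_ideal (R Quot K) (sum_mod R X K)"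
proof -
  let ?Q = "R Quot K" and ?p = "\<lambda>x. K +> x"
  have carr: "carrier ?Q = ?p ` carrier R" by (simp add: FactRing_def A_RCOSETS_def' UNION_singleton_eq_range)
  have zero: "\<zero>\<^bsub>?Q\<^esub> = K" by (simp add: FactRing_def)
  interpret K: ideal K R by fact
  interpret p: ring_hom_ring R ?Q ?p by (rule K.rcos_ring_hom_ring)
  have Q: "right_module ?Q (regular_rmod ?Q)"
    by (rule regular_right_module) (rule p.S.ring_axioms)
  have XK: "right_ideal R (X <+>\<^bsub>R\<^esub> K)" using X right_ideal_ideal[OF K] by (rule right_ideal_set_add)
  then have XK': "additive_subgroup (X <+>\<^bsub>R\<^esub> K) R" by (simp add: right_ideal_iff)
  have J: "right_ideal ?Q (sum_mod R X K)"
    unfolding right_ideal_iff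
  proof (intro conjI ballI)
    show "additive_subgroup (sum_mod R X K) ?Q"
      unfolding sum_mod_def using p.img_is_add_subgroup XK'
      by (intro additive_subgroupI) (simp add: additive_subgroup_def)
    fix x a assume "x \<in> sum_mod R X K" "a \<in> carrier ?Q"
    then obtain y b where "y \<in> X <+>\<^bsub>R\<^esub> K" "x = ?p y" "b \<in> carrier R" "a = ?p b"
      by (auto simp: sum_mod_def carr)
    moreover from this have "?p (y \<otimes> b) = x \<otimes>\<^bsub>?Q\<^esub> a" using right_ideal_subset[OF XK] by auto
    ultimately show "x \<otimes>\<^bsub>?Q\<^esub> a \<in> sum_mod R X K"
      using XK unfolding sum_mod_def right_ideal_iff by (metis image_eqI)
  qed
  have "fin_gen_rmod ?Q ((regular_rmod ?Q)\<lparr>carrier := sum_mod R X K\<rparr>)"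
  proof (rule right_module.fin_gen_submoduleI[OF Q J, of "?p ` F"])
    show "?p ` F \<subseteq> sum_mod R X K"
      using F subset_set_add1[OF K.additive_subgroup_axioms right_ideal_subset[OF X]]
      by (auto simp: sum_mod_def)
    fix L assume L: "right_ideal ?Q L" "?p ` F \<subseteq> L"
    then interpret L: additive_subgroup L ?Q by (simp add: right_ideal_iff)
    let ?L = "{x \<in> carrier R. ?p x \<in> L}"
    have L': "right_ideal R ?L"
      unfolding right_ideal_iff
    proof (intro conjI ballI)
      show "additive_subgroup ?L R"
        by (rule p.additive_subgroup_preimage[OF L.additive_subgroup_axioms])
      fix x a assume x: "x \<in> ?L" and a: "a \<in> carrier R"
      then have "?p x \<otimes>\<^bsub>?Q\<^esub> ?p a \<in> L"
        using L(1) p.hom_closed[OF a] by (simp only: right_ideal_iff mem_Collect_eq)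
      moreover have "?p (x \<otimes> a) = ?p x \<otimes>\<^bsub>?Q\<^esub> ?p a" using x a by (intro p.hom_mult) blast+
      moreover have "x \<otimes> a \<in> carrier R" using x a by blast
      ultimately show "x \<otimes> a \<in> ?L" by (simp only: mem_Collect_eq)
    qed
    \<comment> \<open>Every element of \<open>K\<close> has coset \<open>K\<close>, which is the
      zero of the quotient ring.\<close>
    have KL: "K \<subseteq> ?L"
    proof
      fix x assume x: "x \<in> K"
      have "?p x \<in> L"
        using L.zero_closed unfolding zero K.a_rcos_const[OF x] .
      then show "x \<in> ?L" using K.a_Hcarr[OF x] by blast
    qed
    moreover have "F \<subseteq> ?L" using F L(2) right_ideal_subset[OF X] by blast
    ultimately have "X \<subseteq> ?L" using L' min by blast
    then have "X <+>\<^bsub>R\<^esub> K \<subseteq> ?L"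
      using L' KL unfolding right_ideal_iff by (intro set_add_subset) blast+
    then show "sum_mod R X K \<subseteq> L" unfolding sum_mod_def by blast
  qed (use F in simp)
  with J show ?thesis by (simp add: fin_gen_right_ideal_def)
qed

end

section \<open>Idempotent column finite matrices\<close>

locale idempotent_matrix = ring R for R (structure) +
  fixes A :: "nat \<Rightarrow> nat \<Rightarrow> 'a"
  assumes entry: "\<lbrakk>i \<ge> 1; j \<ge> 1\<rbrakk> \<Longrightarrow> A i j \<in> carrier R"
    and column_finite: "column_finite R A"
    and idem: "\<lbrakk>i \<ge> 1; j \<ge> 1\<rbrakk> \<Longrightarrow> mat_mult R A A i j = A i j"
begin

text \<open>This is the index set of the sum in \<open>mat_mult R A A i j\<close>; column finiteness
  makes it finite.\<close>

definition col_supp :: "nat \<Rightarrow> nat set"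
  where "col_supp j = {l \<in> {1..}. A l j \<noteq> \<zero>}"

text \<open>Coordinate 0 is set to zero because vectors of the free module vanish there, whereas
  \<open>A 0 j\<close> is arbitrary.\<close>

definition col :: "nat \<Rightarrow> nat \<Rightarrow> 'a"
  where "col j = (\<lambda>i. if i = 0 then \<zero> else A i j)"

abbreviation P :: "('a, nat \<Rightarrow> 'a) rmod"
  where "P \<equiv> mat_image R A"

abbreviation I :: "nat \<Rightarrow> 'a set"
  where "I \<equiv> tail_ideal R A"

abbreviation RI :: "nat \<Rightarrow> 'a set"
  where "RI k \<equiv> prod_sets R (carrier R) (I k)"

text \<open>All later uses of the idempotency of \<open>A\<close> pass through this
  expansion.\<close>

lemma entry_expand:
  "\<lbrakk>i \<ge> 1; j \<ge> 1\<rbrakk> \<Longrightarrow> A i j = (\<Oplus>l\<in>col_supp j. A i l \<otimes> A l j)"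
  using idem[of i j] by (simp add: mat_mult_def col_supp_def)

lemma entry_in_additive_subgroup:
  assumes "i \<ge> 1" and "j \<ge> 1" and "additive_subgroup N R"
    and "\<And>l. l \<ge> 1 \<Longrightarrow> A i l \<otimes> A l j \<in> N"
  shows "A i j \<in> N"
  unfolding entry_expand[OF assms(1,2)]
  by (rule finsum_in_additive_subgroup) (use assms in \<open>auto simp: col_supp_def\<close>)

lemma finite_col_supp: "j \<ge> 1 \<Longrightarrow> finite (col_supp j)"
  using column_finite by (simp add: col_supp_def column_finite_def)

lemma tail_ideal_eq:
  "I k = sum_sets R ((\<lambda>a. a <#\<^bsub>R\<^esub> carrier R) ` {A i j | i j. k < i \<and> 1 \<le> j})"
  unfolding tail_ideal_def by (rule arg_cong[where f = "sum_sets R"]) auto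

lemma tail_entries: "{A i j | i j. k < i \<and> 1 \<le> j} \<subseteq> carrier R"
  using entry by auto

lemma right_ideal_tail: "right_ideal R (I k)"
  unfolding tail_ideal_eq using tail_entries by (rule right_ideal_sum_principal)

lemma entry_in_tail: "\<lbrakk>k < i; 1 \<le> j\<rbrakk> \<Longrightarrow> A i j \<in> I k"
  unfolding tail_ideal_eq using generators_in_sum_principal[OF tail_entries] by blast

lemma tail_subset:
  assumes "right_ideal R N" and "\<And>i j. \<lbrakk>k < i; 1 \<le> j\<rbrakk> \<Longrightarrow> A i j \<in> N"
  shows "I k \<subseteq> N"
  unfolding tail_ideal_eq using assms by (intro sum_principal_subset) auto

lemma ideal_RI: "ideal (RI k) R"
  using right_ideal_tail by (rule ideal_prod_carrier)

lemma tail_subset_RI: "I k \<subseteq> RI k"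
  using right_ideal_subset[OF right_ideal_tail] by (rule subset_prod_carrier)

lemma entry_in_RI: "\<lbrakk>k < i; 1 \<le> j\<rbrakk> \<Longrightarrow> A i j \<in> RI k"
  using entry_in_tail tail_subset_RI by blast

text \<open>In the expansion of \<open>A i j\<close>, a term with \<open>l \<le> k\<close> lies in
  \<open>N\<close> because \<open>A i l\<close> does and \<open>N\<close> is a right ideal; a term
  with \<open>l > k\<close> has its second factor in \<open>RI k\<close>, a two-sided ideal inside
  \<open>N\<close>. Both claims of (ii) rest on this.\<close>

lemma entry_in_right_ideal:
  assumes "i \<ge> 1" and "j \<ge> 1" and N: "right_ideal R N" and "RI k \<subseteq> N"
    and l: "\<And>l. \<lbrakk>1 \<le> l; l \<le> k\<rbrakk> \<Longrightarrow> A i l \<in> N"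
  shows "A i j \<in> N"
proof (rule entry_in_additive_subgroup[OF assms(1,2)])
  show "additive_subgroup N R" using N by (simp add: right_ideal_iff)
  fix l :: nat assume l1: "l \<ge> 1"
  show "A i l \<otimes> A l j \<in> N"
  proof (cases "l \<le> k")
    case True
    then show ?thesis using l[OF l1] N entry[OF l1 assms(2)] by (simp add: right_ideal_iff)
  next
    case False
    then have "A l j \<in> RI k" using assms(2) by (intro entry_in_RI) auto
    then have "A i l \<otimes> A l j \<in> RI k"
      using ideal.I_l_closed[OF ideal_RI] entry[OF assms(1) l1] by blast
    then show ?thesis using assms(4) by blast
  qed
qed

subsection \<open>Rows modulo tail ideals\<close>

text \<open>The two sums agree already in \<open>R\<close> after adding \<open>RI k\<close>. The
  nontrivial inclusion applies \<open>entry_in_right_ideal\<close> to the right ideal of the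
  truncated row plus \<open>RI k\<close>.\<close>

lemma row_ideal_mod_tail:
  assumes i: "0 < i"
  shows "sum_mod R (sum_sets R {A i j <#\<^bsub>R\<^esub> carrier R | j. j \<ge> 1}) (RI k) =
    sum_mod R (sum_sets R {A i l <#\<^bsub>R\<^esub> carrier R | l. 1 \<le> l \<and> l \<le> k}) (RI k)"
proof -
  let ?T = "{A i j | j. j \<ge> 1}" and ?U = "{A i l | l. 1 \<le> l \<and> l \<le> k}"
  let ?s = "\<lambda>T. sum_sets R ((\<lambda>a. a <#\<^bsub>R\<^esub> carrier R) ` T)"
  have eq: "{A i j <#\<^bsub>R\<^esub> carrier R | j. j \<ge> 1} = (\<lambda>a. a <#\<^bsub>R\<^esub> carrier R) ` ?T"
    "{A i l <#\<^bsub>R\<^esub> carrier R | l. 1 \<le> l \<and> l \<le> k} = (\<lambda>a. a <#\<^bsub>R\<^esub> carrier R) ` ?U" by auto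
  have carr: "?T \<subseteq> carrier R" "?U \<subseteq> carrier R" using i entry by auto
  note T = right_ideal_sum_principal[OF carr(1)] and U = right_ideal_sum_principal[OF carr(2)]
  have RI: "right_ideal R (RI k)" by (rule right_ideal_ideal[OF ideal_RI])
  have UK: "right_ideal R (?s ?U <+>\<^bsub>R\<^esub> RI k)" using U RI by (rule right_ideal_set_add)
  have U_sub: "?U \<subseteq> ?s ?U <+>\<^bsub>R\<^esub> RI k"
    using generators_in_sum_principal[OF carr(2)] RI right_ideal_subset[OF U]
      subset_set_add1[of "RI k" "?s ?U"] by (auto simp: right_ideal_iff)
  have K_sub: "RI k \<subseteq> ?s ?U <+>\<^bsub>R\<^esub> RI k"
    using U right_ideal_subset[OF RI] by (intro subset_set_add2) (auto simp: right_ideal_iff)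
  have "?T \<subseteq> ?s ?U <+>\<^bsub>R\<^esub> RI k"
    using i entry_in_right_ideal[OF _ _ UK K_sub, of i] U_sub by auto
  then have "?s ?T \<subseteq> ?s ?U <+>\<^bsub>R\<^esub> RI k" by (rule sum_principal_subset[OF UK])
  then have "?s ?T <+>\<^bsub>R\<^esub> RI k \<subseteq> ?s ?U <+>\<^bsub>R\<^esub> RI k"
    using UK K_sub by (intro set_add_subset) (auto simp: right_ideal_iff)
  moreover have "?s ?U \<subseteq> ?s ?T"
    using generators_in_sum_principal[OF carr(1)] by (intro sum_principal_subset[OF T]) auto
  then have "?s ?U <+>\<^bsub>R\<^esub> RI k \<subseteq> ?s ?T <+>\<^bsub>R\<^esub> RI k" unfolding set_add_def' by blast
  ultimately have "?s ?T <+>\<^bsub>R\<^esub> RI k = ?s ?U <+>\<^bsub>R\<^esub> RI k" by (rule subset_antisym)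
  then show ?thesis unfolding eq sum_mod_def by (rule arg_cong)
qed

lemma fin_gen_tail_mod_tail: "fin_gen_right_ideal (R Quot RI k) (sum_mod R (I n) (RI k))"
proof (rule fin_gen_right_ideal_sum_modI[OF ideal_RI right_ideal_tail])
  \<comment> \<open>Rows beyond \<open>k\<close> vanish modulo \<open>RI k\<close>, and each
    remaining row is generated by its first \<open>k\<close> entries.\<close>
  let ?F = "(\<lambda>(i, l). A i l) ` ({n<..k} \<times> {1..k})"
  show "finite ?F" by simp
  show "?F \<subseteq> I n" using entry_in_tail by auto
  fix L assume L: "right_ideal R L" "RI k \<subseteq> L" "?F \<subseteq> L"
  show "I n \<subseteq> L"
  proof (rule tail_subset[OF L(1)])
    fix i j :: nat assume ij: "n < i" "1 \<le> j"
    show "A i j \<in> L"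
    proof (cases "i \<le> k")
      case True
      have "A i l \<in> L" if "1 \<le> l" "l \<le> k" for l
        using L(3) ij(1) True that by force
      moreover have "1 \<le> i" using ij(1) by simp
      ultimately show ?thesis using entry_in_right_ideal[OF _ ij(2) L(1,2)] by blast
    next
      case False
      then have "A i j \<in> RI k" using ij(2) by (intro entry_in_RI) simp_all
      then show ?thesis using L(2) by blast
    qed
  qed
qed

section \<open>Products of two tail ideals\<close>

lemma tail_prod_tail:
  obtains n where "n > k" and "prod_sets R (I n) (I k) = I n"
proof -
  have "finite (\<Union>l\<in>{1..k}. col_supp l)" using finite_col_supp by auto
  then obtain m where m: "\<And>i. i \<in> (\<Union>l\<in>{1..k}. col_supp l) \<Longrightarrow> i \<le> m"
    unfolding finite_nat_set_iff_bounded_le by blast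
  \<comment> \<open>\<open>m\<close> bounds the supports of the first \<open>k\<close> columns; the
    maximum with \<open>Suc k\<close> forces \<open>n > k\<close>.\<close>
  define n where "n = max m (Suc k)"
  have nk: "n > k" by (simp add: n_def)
  have zero: "A i l = \<zero>" if "n < i" "1 \<le> l" "l \<le> k" for i l
    using m[of i] that by (force simp: n_def col_supp_def)
  have r: "right_ideal R (prod_sets R (I n) (I k))"
    using right_ideal_subset[OF right_ideal_tail] right_ideal_tail by (rule right_ideal_prod_sets)
  then have sub: "additive_subgroup (prod_sets R (I n) (I k)) R" by (simp add: right_ideal_iff)
  have "I n \<subseteq> prod_sets R (I n) (I k)"
  proof (rule tail_subset[OF r])
    fix i j :: nat assume ij: "n < i" "1 \<le> j"
    show "A i j \<in> prod_sets R (I n) (I k)"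
    proof (rule entry_in_additive_subgroup[OF _ ij(2) sub])
      fix l :: nat assume l: "l \<ge> 1"
      show "A i l \<otimes> A l j \<in> prod_sets R (I n) (I k)"
      proof (cases "l \<le> k")
        case True
        then show ?thesis
          using zero[OF ij(1) l] entry[OF l ij(2)] additive_subgroup.zero_closed[OF sub] by simp
      next
        case False
        then show ?thesis using ij l by (intro prod_sets_in entry_in_tail) auto
      qed
    qed (use ij in simp)
  qed
  \<comment> \<open>This direction only uses that \<open>I n\<close> is a right ideal.\<close>
  moreover have "prod_sets R (I n) (I k) \<subseteq> I n"
    using right_ideal_tail[of n] right_ideal_subset[OF right_ideal_tail]
    by (intro prod_sets_subset) (auto simp: right_ideal_iff subset_iff)
  ultimately show thesis using that nk by blast
qed

subsection \<open>The projective module\<close>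

lemma right_module_P: "right_module R P"
proof -
  interpret F: right_module R "free_rmod R" by (rule free_right_module) (rule ring_axioms)
  have "right_submodule R (free_rmod R) (carrier P)"
    using entry column_finite by (intro right_submodule_mat_image ring_axioms) auto
  then have "right_module R ((free_rmod R)\<lparr>carrier := carrier P\<rparr>)"
    by (rule F.right_module_submodule)
  then show ?thesis by (simp add: mat_image_def)
qed

sublocale P: right_module R P by (rule right_module_P)

lemma P_simps:
  "\<zero>\<^bsub>P\<^esub> i = \<zero>" "(v \<oplus>\<^bsub>P\<^esub> w) i = v i \<oplus> w i" "(v \<bullet>\<^bsub>P\<^esub> a) i = v i \<otimes> a"
  by (simp_all add: mat_image_def free_rmod_def)

lemma P_coord: "v \<in> carrier P \<Longrightarrow> v i \<in> carrier R"
  using entry by (auto simp: mat_image_def mat_vec_def free_rmod_def)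

lemma col_in_P:
  assumes j: "j \<ge> 1"
  shows "col j \<in> carrier P"
proof -
  have supp: "{l \<in> {1..}. col j l \<noteq> \<zero>} = col_supp j" by (auto simp: col_def col_supp_def)
  have "finite {i. col j i \<noteq> \<zero>}"
    using finite_col_supp[OF j] by (rule rev_finite_subset) (auto simp: col_def col_supp_def)
  then have "col j \<in> carrier (free_rmod R)" using entry j by (auto simp: free_rmod_def col_def)
  \<comment> \<open>Idempotency makes the column its own preimage under \<open>A\<close>.\<close>
  moreover have "mat_vec R A (col j) = col j"
  proof
    fix i
    show "mat_vec R A (col j) i = col j i"
    proof (cases "i = 0")
      case False
      then have "mat_vec R A (col j) i = (\<Oplus>l\<in>col_supp j. A i l \<otimes> col j l)"
        by (simp only: mat_vec_def supp if_False)
      also have "\<dots> = (\<Oplus>l\<in>col_supp j. A i l \<otimes> A l j)"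
        using False j entry by (intro add.finprod_cong') (auto simp: col_def col_supp_def)
      also have "\<dots> = col j i" using False j entry_expand[of i j] by (simp add: col_def)
      finally show ?thesis .
    qed (simp add: mat_vec_def col_def)
  qed
  ultimately show ?thesis by (force simp: mat_image_def)
qed

lemma finsum_P_coord:
  assumes "finite S" and "\<And>l. l \<in> S \<Longrightarrow> f l \<in> carrier P"
  shows "finsum P f S i = (\<Oplus>l\<in>S. f l i)"
  using assms
proof (induction S rule: finite_induct)
  case (insert x S)
  then show ?case by (simp add: P.M.finsum_insert finsum_insert P_simps P_coord Pi_def)
qed (simp add: P_simps)

lemma mat_vec_eq_finsum_col:
  assumes "\<And>l. v l \<in> carrier R" and fin: "finite {l \<in> {1..}. v l \<noteq> \<zero>}"
  shows "mat_vec R A v = finsum P (\<lambda>l. col l \<bullet>\<^bsub>P\<^esub> v l) {l \<in> {1..}. v l \<noteq> \<zero>}"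
proof
  fix i
  have "finsum P (\<lambda>l. col l \<bullet>\<^bsub>P\<^esub> v l) {l \<in> {1..}. v l \<noteq> \<zero>} i =
      (\<Oplus>l\<in>{l \<in> {1..}. v l \<noteq> \<zero>}. col l i \<otimes> v l)"
    using assms col_in_P by (subst finsum_P_coord) (auto simp: P_simps)
  \<comment> \<open>At \<open>i = 0\<close> all summands vanish, in agreement with the default value
    of \<open>mat_vec\<close>.\<close>
  also have "\<dots> = mat_vec R A v i"
    using assms(1) by (simp add: mat_vec_def col_def add.finprod_one_eqI)
  finally show "mat_vec R A v i = finsum P (\<lambda>l. col l \<bullet>\<^bsub>P\<^esub> v l) {l \<in> {1..}. v l \<noteq> \<zero>} i" ..
qed

text \<open>The columnwise reading of \<open>entry_expand\<close>; at coordinate 0 both sides are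
  zero.\<close>

lemma col_expand:
  assumes j: "j \<ge> 1"
  shows "col j = finsum P (\<lambda>l. col l \<bullet>\<^bsub>P\<^esub> A l j) (col_supp j)"
proof
  fix i
  have "finsum P (\<lambda>l. col l \<bullet>\<^bsub>P\<^esub> A l j) (col_supp j) i = (\<Oplus>l\<in>col_supp j. col l i \<otimes> A l j)"
    using finite_col_supp[OF j] col_in_P entry j
    by (subst finsum_P_coord) (auto simp: P_simps col_supp_def)
  also have "\<dots> = col j i"
  proof (cases "i = 0")
    case True
    then show ?thesis
      using entry j by (auto simp: col_def col_supp_def intro!: add.finprod_one_eqI)
  next
    case False
    then show ?thesis using entry_expand[of i j] j by (simp add: col_def)
  qed
  finally show "col j i = finsum P (\<lambda>l. col l \<bullet>\<^bsub>P\<^esub> A l j) (col_supp j) i" ..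
qed

text \<open>The columns generate \<open>P\<close>, since applying \<open>A\<close> to
  \<open>v\<close> gives the combination of columns with coefficients \<open>v l\<close>.\<close>

lemma P_subset:
  assumes N: "right_submodule R P N" and "\<And>j. j \<ge> 1 \<Longrightarrow> col j \<in> N"
  shows "carrier P \<subseteq> N"
proof
  fix x assume "x \<in> carrier P"
  then obtain v where v: "x = mat_vec R A v" "\<And>l. v l \<in> carrier R" "finite {l. v l \<noteq> \<zero>}"
    by (auto simp: mat_image_def free_rmod_def)
  then have "x = finsum P (\<lambda>l. col l \<bullet>\<^bsub>P\<^esub> v l) {l \<in> {1..}. v l \<noteq> \<zero>}"
    using mat_vec_eq_finsum_col by simp
  also have "\<dots> \<in> N"
    using N assms(2) v(2) by (intro P.M.finsum_in_additive_subgroup) (auto simp: right_submodule_def)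
  finally show "x \<in> N" .
qed

lemma col_in_additive_subgroup:
  assumes "j \<ge> 1" and "additive_subgroup N P" and "\<And>l. l \<ge> 1 \<Longrightarrow> col l \<bullet>\<^bsub>P\<^esub> A l j \<in> N"
  shows "col j \<in> N"
  by (subst col_expand[OF assms(1)], rule P.M.finsum_in_additive_subgroup)
    (use assms in \<open>auto simp: col_supp_def\<close>)

text \<open>The first \<open>k\<close> columns generate \<open>P\<close> modulo
  \<open>rmod_prod P (RI k)\<close>: in \<open>col_expand\<close>, the terms with
  \<open>l > k\<close> have their coefficient \<open>A l j\<close> in \<open>RI k\<close>.\<close>

lemma RI_in_fin_gen_quotient_ideals: "RI k \<in> fin_gen_quotient_ideals R P"
proof -
  have prod: "right_submodule R P (rmod_prod P (RI k))"
    using ideal_RI by (rule P.right_submodule_rmod_prod)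
  have "fin_gen_rmod R (quotient_rmod P (rmod_prod P (RI k)))"
  proof (rule P.fin_gen_quotientI[OF prod])
    show "finite (col ` {1..k})" by simp
    show "col ` {1..k} \<subseteq> carrier P" using col_in_P by auto
    fix L assume L: "right_submodule R P L" "rmod_prod P (RI k) \<subseteq> L" "col ` {1..k} \<subseteq> L"
    show "carrier P \<subseteq> L"
    proof (rule P_subset[OF L(1)])
      fix j :: nat assume j: "j \<ge> 1"
      show "col j \<in> L"
      proof (rule col_in_additive_subgroup[OF j])
        show "additive_subgroup L P" using L(1) by (simp add: right_submodule_def)
        fix l :: nat assume l: "l \<ge> 1"
        show "col l \<bullet>\<^bsub>P\<^esub> A l j \<in> L"
        proof (cases "l \<le> k")
          case True
          then have "col l \<in> L" using L(3) l by auto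
          then show ?thesis using L(1) entry[OF l j] by (simp add: right_submodule_def)
        next
          case False
          then have "A l j \<in> RI k" using j by (intro entry_in_RI) auto
          then have "col l \<bullet>\<^bsub>P\<^esub> A l j \<in> rmod_prod P (RI k)"
            unfolding rmod_prod_def using col_in_P[OF l] by (intro generate.incl) blast
          then show ?thesis using L(2) by blast
        qed
      qed
    qed
  qed
  then show ?thesis by (simp add: fin_gen_quotient_ideals_def ideal_RI)
qed

subsection \<open>The trace ideal\<close>

lemma rmod_hom_regular:
  assumes "f \<in> rmod_hom R P (regular_rmod R)"
  shows "abelian_group_hom P R f"
    and "\<lbrakk>x \<in> carrier P; a \<in> carrier R\<rbrakk> \<Longrightarrow> f (x \<bullet>\<^bsub>P\<^esub> a) = f x \<otimes> a"
proof -
  show "abelian_group_hom P R f"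
    using assms
    by (intro abelian_group_homI' P.M.abelian_group_axioms abelian_group_axioms)
      (auto simp: rmod_hom_def hom_def regular_rmod_def)
  show "f (x \<bullet>\<^bsub>P\<^esub> a) = f x \<otimes> a" if "x \<in> carrier P" "a \<in> carrier R"
    using assms that by (auto simp: rmod_hom_def regular_rmod_def)
qed

text \<open>Left multiplication by \<open>r\<close> commutes with the right action. These maps
  supply enough homomorphisms to reach all of \<open>RI 0\<close>.\<close>

lemma coord_rmod_hom:
  assumes "r \<in> carrier R"
  shows "(\<lambda>x. r \<otimes> x i) \<in> rmod_hom R P (regular_rmod R)"
  using assms
  by (auto simp: rmod_hom_def hom_def regular_rmod_def P_simps P_coord r_distr m_assoc)

lemma additive_subgroup_trace: "additive_subgroup (trace_ideal R P) R"
  unfolding trace_ideal_def sum_sets_def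
  by (rule additive_subgroup_generate)
    (auto simp: rmod_hom_def hom_def regular_rmod_def)

lemma trace_subset: "trace_ideal R P \<subseteq> RI 0"
proof -
  interpret RI: ideal "RI 0" R by (rule ideal_RI)
  have "f x \<in> RI 0" if f: "f \<in> rmod_hom R P (regular_rmod R)" and x: "x \<in> carrier P" for f x
  proof -
    interpret f: abelian_group_hom P R f using f by (rule rmod_hom_regular)
    \<comment> \<open>As \<open>RI 0\<close> is an ideal, its preimage is a submodule, so only the
      columns need to be tested; there \<open>col_expand\<close> exhibits a factor
      \<open>A l j\<close> in \<open>I 0\<close>.\<close>
    let ?N = "{x \<in> carrier P. f x \<in> RI 0}"
    have sub: "additive_subgroup ?N P"
      by (rule f.additive_subgroup_preimage) (rule RI.additive_subgroup_axioms)
    then have N: "right_submodule R P ?N"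
      using rmod_hom_regular(2)[OF f] RI.I_r_closed by (auto simp: right_submodule_def)
    have "carrier P \<subseteq> ?N"
    proof (rule P_subset[OF N])
      fix j :: nat assume j: "j \<ge> 1"
      show "col j \<in> ?N"
      proof (rule col_in_additive_subgroup[OF j sub])
        fix l :: nat assume l: "l \<ge> 1"
        have "f (col l \<bullet>\<^bsub>P\<^esub> A l j) = f (col l) \<otimes> A l j"
          using f col_in_P[OF l] entry[OF l j] by (rule rmod_hom_regular)
        moreover have "A l j \<in> I 0" using l j by (intro entry_in_tail) auto
        ultimately show "col l \<bullet>\<^bsub>P\<^esub> A l j \<in> ?N"
          using col_in_P[OF l] entry[OF l j] by (simp add: prod_sets_in)
      qed
    qed
    then show ?thesis using x by blast
  qed
  then show ?thesis
    unfolding trace_ideal_def sum_sets_def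
    by (intro generate_subset_additive_subgroup RI.additive_subgroup_axioms) auto
qed

text \<open>On generators, \<open>r \<otimes> (A i j \<otimes> s)\<close> is the value of the map
  sending \<open>x\<close> to \<open>r \<otimes> x i\<close> at the \<open>j\<close>-th column times
  \<open>s\<close>.\<close>

lemma RI_subset_trace: "RI 0 \<subseteq> trace_ideal R P"
proof (rule prod_sets_subset[OF additive_subgroup_trace])
  fix r b assume r: "r \<in> carrier R" and b: "b \<in> I 0"
  show "r \<otimes> b \<in> trace_ideal R P"
  proof (rule abelian_group_hom.generate_in_preimage[OF l_mult_hom[OF r] additive_subgroup_trace])
    let ?S = "\<Union> {A i j <#\<^bsub>R\<^esub> carrier R | i j. i > 0 \<and> j \<ge> 1}"
    show "b \<in> generate (add_monoid R) ?S" using b by (simp add: tail_ideal_def sum_sets_def)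
    show "?S \<subseteq> carrier R" using entry by (auto simp: l_coset_def)
    fix y assume "y \<in> ?S"
    then obtain i j s where y: "y = A i j \<otimes> s" "i > 0" "j \<ge> 1" "s \<in> carrier R"
      by (auto simp: l_coset_def)
    \<comment> \<open>Here \<open>i > 0\<close> ensures that \<open>col j i\<close> is
      \<open>A i j\<close> and not the default zero.\<close>
    have "r \<otimes> y = r \<otimes> (col j \<bullet>\<^bsub>P\<^esub> s) i" using y by (simp add: P_simps col_def)
    moreover have "col j \<bullet>\<^bsub>P\<^esub> s \<in> carrier P" using col_in_P y by simp
    ultimately have "r \<otimes> y \<in> (\<lambda>x. r \<otimes> x i) ` carrier P" by blast
    then show "r \<otimes> y \<in> trace_ideal R P"
      unfolding trace_ideal_def sum_sets_def
      using coord_rmod_hom[OF r, of i] by (intro generate.incl) blast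
  qed
qed

end

theorem lemma5p1:
  fixes R :: "('a, 'r) ring_scheme" and A :: "nat \<Rightarrow> nat \<Rightarrow> 'a"
  assumes "ring R"
    and "\<forall>i\<in>{1..}. \<forall>j\<in>{1..}. A i j \<in> carrier R"
    and "column_finite R A"
    and "\<forall>i\<in>{1..}. \<forall>j\<in>{1..}. mat_mult R A A i j = A i j"
  shows
    "trace_ideal R (mat_image R A) = prod_sets R (carrier R) (tail_ideal R A 0) \<and>
     (\<forall>k i. 0 < i \<and> i \<le> k \<longrightarrow>
        sum_mod R (sum_sets R {A i j <#\<^bsub>R\<^esub> carrier R | j. j \<ge> 1})
          (prod_sets R (carrier R) (tail_ideal R A k)) =
        sum_mod R (sum_sets R {A i l <#\<^bsub>R\<^esub> carrier R | l. 1 \<le> l \<and> l \<le> k})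
          (prod_sets R (carrier R) (tail_ideal R A k))) \<and>
     (\<forall>k n. n \<le> k \<longrightarrow>
        fin_gen_right_ideal (R Quot prod_sets R (carrier R) (tail_ideal R A k))
          (sum_mod R (tail_ideal R A n) (prod_sets R (carrier R) (tail_ideal R A k)))) \<and>
     (\<forall>k. prod_sets R (carrier R) (tail_ideal R A k)
        \<in> fin_gen_quotient_ideals R (mat_image R A)) \<and>
     (\<forall>k. \<exists>n>k. prod_sets R (tail_ideal R A n) (tail_ideal R A k) = tail_ideal R A n)"
proof -
  interpret idempotent_matrix R A
    using assms by (intro idempotent_matrix.intro idempotent_matrix_axioms.intro) auto
  show ?thesis
    using trace_subset RI_subset_trace row_ideal_mod_tail fin_gen_tail_mod_tail
      RI_in_fin_gen_quotient_ideals tail_prod_tail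
    by (intro conjI allI impI) (auto, metis)
qed

end
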